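(* Let $\mathcal{H}$ be an RBK-tournament (respectively, a geometric RBK-tournament) on $M$ vertices, labeled $1,\dots,M$. Consider any nonnegative reals $B_1,\dots,B_M$ and $R_1,\dots,R_M$. Let $B=\max_P\sum_{i\in P}B_i$ and $R=\max_Q\sum_{j\in Q}R_j$, where $P$ and $Q$ run over directed paths (respectively, cliques) in $\mathcal{H}$ of color $BK$ and $RK$, respectively. Then $$B\cdot R\ \ge\ \sum_{i=1}^{M}B_i\cdot R_i .$$
   Context: An *RBK-tournament* is a transitive tournament on ordered vertices $1,\dots,M$ (edges $i\to j$ for $i<j$) with each edge colored one of three colors $R,B,K$. A directed path or clique (set of vertices) *has color $BK$* if each of its edges (for a clique: each edge between two of its vertices) is colored $B$ or $K$; similarly for $RK$. Single vertices count as paths and cliques. A tournament is *transitive in a color class $C$* if for all $i<j<k$, whenever edges $i\to j$ and $j\to k$ have colors in $C$, so does $i\to k$. An RBK-tournament is *geometric* if it is transitive in each of the color classes $\{R\},\{B\},\{R,K\},\{B,K\}$. (The symbols $B,R$ for the maxima and $B_i,R_i$ for the weights are real numbers, not colors.) *)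

theory Defs
  imports Complex_Main
begin

text \<open>An RBK-tournament on the vertices 1, ..., M is given by M and a colouring c of the edges
  i \<open>\<rightarrow>\<close> j with i < j; the values of c off the edges are irrelevant.\<close>

datatype rbk_colour = Col_R | Col_B | Col_K

definition tedge :: "nat \<Rightarrow> nat \<Rightarrow> nat \<Rightarrow> bool" where
  "tedge M i j \<longleftrightarrow> 1 \<le> i \<and> i < j \<and> j \<le> M"

definition transitive_in ::
    "nat \<Rightarrow> (nat \<Rightarrow> nat \<Rightarrow> rbk_colour) \<Rightarrow> rbk_colour set \<Rightarrow> bool" where
  "transitive_in M c C \<longleftrightarrow>
     (\<forall>i j k. tedge M i j \<longrightarrow> tedge M j k \<longrightarrow> c i j \<in> C \<longrightarrow> c j k \<in> C \<longrightarrow> c i k \<in> C)"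

definition geometric_tournament :: "nat \<Rightarrow> (nat \<Rightarrow> nat \<Rightarrow> rbk_colour) \<Rightarrow> bool" where
  "geometric_tournament M c \<longleftrightarrow>
     transitive_in M c {Col_R} \<and> transitive_in M c {Col_B} \<and>
     transitive_in M c {Col_R, Col_K} \<and> transitive_in M c {Col_B, Col_K}"

text \<open>A directed path is the nonempty list of its vertices. It is strictly increasing, hence
  distinct, so its weight may be summed over its vertex set.\<close>

definition coloured_path ::
    "nat \<Rightarrow> (nat \<Rightarrow> nat \<Rightarrow> rbk_colour) \<Rightarrow> rbk_colour set \<Rightarrow> nat list \<Rightarrow> bool" where
  "coloured_path M c C P \<longleftrightarrow>
     P \<noteq> [] \<and> set P \<subseteq> {1..M} \<and> successively (\<lambda>i j. tedge M i j \<and> c i j \<in> C) P"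

definition coloured_clique ::
    "nat \<Rightarrow> (nat \<Rightarrow> nat \<Rightarrow> rbk_colour) \<Rightarrow> rbk_colour set \<Rightarrow> nat set \<Rightarrow> bool" where
  "coloured_clique M c C Q \<longleftrightarrow>
     Q \<noteq> {} \<and> Q \<subseteq> {1..M} \<and> (\<forall>i\<in>Q. \<forall>j\<in>Q. i < j \<longrightarrow> c i j \<in> C)"

definition max_path_weight ::
    "nat \<Rightarrow> (nat \<Rightarrow> nat \<Rightarrow> rbk_colour) \<Rightarrow> rbk_colour set \<Rightarrow> (nat \<Rightarrow> real) \<Rightarrow> real" where
  "max_path_weight M c C w = Max {\<Sum>i\<in>set P. w i | P. coloured_path M c C P}"

definition max_clique_weight ::
    "nat \<Rightarrow> (nat \<Rightarrow> nat \<Rightarrow> rbk_colour) \<Rightarrow> rbk_colour set \<Rightarrow> (nat \<Rightarrow> real) \<Rightarrow> real" where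
  "max_clique_weight M c C w = Max {\<Sum>i\<in>Q. w i | Q. coloured_clique M c C Q}"

end

theory Submission
  imports Defs "HOL-Analysis.Henstock_Kurzweil_Integration"
begin

text \<open>The product on the left is the area of a box into which rectangles of areas
  \<open>b i * r i\<close> can be packed. Give vertex \<open>i\<close> the point of the plane whose abscissa is the
  greatest \<open>b\<close>-weight of a \<open>BK\<close>-path ending at \<open>i\<close> and whose ordinate is the greatest
  \<open>r\<close>-weight of an \<open>RK\<close>-path ending at \<open>i\<close>. The rectangle with that point as its upper right
  corner, of width \<open>b i\<close> and height \<open>r i\<close>, lies in the box, because the path \<open>[i]\<close> makes
  both coordinates large enough (lemma \<open>heaviest_ending_singleton\<close>).

  For \<open>i < j\<close> the edge from \<open>i\<close> to \<open>j\<close> has a colour in \<open>BK\<close> or in \<open>RK\<close>. In the first case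
  any \<open>BK\<close>-path ending at \<open>i\<close> can be prolonged by \<open>j\<close>, so the abscissa grows by at least
  \<open>b j\<close> and the rectangle of \<open>j\<close> lies to the right of that of \<open>i\<close>; in the second case it lies
  above (lemma \<open>heaviest_ending_edge\<close>). The rectangles therefore have disjoint interiors, and
  comparing areas (lemma \<open>sum_areas_le_area\<close>) gives the inequality for paths.

  In a geometric tournament transitivity in \<open>BK\<close> turns the vertex set of each \<open>BK\<close>-path into
  a \<open>BK\<close>-clique, and likewise for \<open>RK\<close>, so the maxima over cliques are at least as large as
  those over paths (lemma \<open>max_path_weight_le_max_clique_weight\<close>).\<close>

section \<open>Packing rectangles into a box\<close>

lemma content_box_Pair:
  fixes x y x' y' :: real
  assumes "x \<le> x'" "y \<le> y'"
  shows "measure lborel (box (x, y) (x', y')) = (x' - x) * (y' - y)"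
proof -
  have "measure lborel (box (x, y) (x', y')) = measure lborel (cbox (x, y) (x', y'))"
    by (simp only: measure_lborel_box_eq measure_lborel_cbox_eq)
  then show ?thesis
    using assms by (simp add: content_Pair)
qed

text \<open>The rectangles are open, so that touching neighbours are disjoint.\<close>

lemma sum_areas_le_area:
  fixes f g b r :: "'a \<Rightarrow> real"
  assumes "finite I"
    and "\<And>i. i \<in> I \<Longrightarrow> 0 \<le> b i \<and> b i \<le> f i \<and> f i \<le> X"
    and "\<And>i. i \<in> I \<Longrightarrow> 0 \<le> r i \<and> r i \<le> g i \<and> g i \<le> Y"
    and "0 \<le> X" "0 \<le> Y"
    and sep: "\<And>i j. \<lbrakk>i \<in> I; j \<in> I; i \<noteq> j\<rbrakk> \<Longrightarrow>
      f i \<le> f j - b j \<or> f j \<le> f i - b i \<or> g i \<le> g j - r j \<or> g j \<le> g i - r i"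
  shows "(\<Sum>i\<in>I. b i * r i) \<le> X * Y"
proof -
  define A where "A i = box (f i - b i, g i - r i) (f i, g i)" for i
  have area: "measure lborel (A i) = b i * r i" if "i \<in> I" for i
    using assms(2,3)[OF that] by (simp add: A_def content_box_Pair)
  have disj: "disjoint_family_on A I"
    unfolding disjoint_family_on_def A_def box_prod
    by (fastforce dest: sep)
  have "(\<Sum>i\<in>I. b i * r i) = (\<Sum>i\<in>I. measure lborel (A i))"
    using area by simp
  also have "\<dots> = measure lborel (\<Union>i\<in>I. A i)"
    using emeasure_lborel_box_finite
    by (intro measure_finite_Union[symmetric] disj \<open>finite I\<close>) (auto simp: A_def less_top)
  also have "\<dots> \<le> measure lborel (box (0, 0) (X, Y))"
  proof (rule measure_mono_fmeasurable)
    show "(\<Union>i\<in>I. A i) \<subseteq> box (0, 0) (X, Y)"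
      using assms(2,3) by (fastforce simp: A_def box_prod)
    show "(\<Union>i\<in>I. A i) \<in> sets lborel"
      by (auto simp: A_def intro!: borel_open)
    show "box (0, 0) (X, Y) \<in> fmeasurable lborel"
      using emeasure_lborel_box_finite by (intro fmeasurableI) auto
  qed
  also have "\<dots> = X * Y"
    using assms(4,5) by (simp add: content_box_Pair)
  finally show ?thesis .
qed

section \<open>Heaviest paths with a prescribed end\<close>

definition heaviest_ending ::
    "nat \<Rightarrow> (nat \<Rightarrow> nat \<Rightarrow> rbk_colour) \<Rightarrow> rbk_colour set \<Rightarrow> (nat \<Rightarrow> real) \<Rightarrow> nat \<Rightarrow> real" where
  "heaviest_ending M c C w j = Max {\<Sum>i\<in>set P. w i | P. coloured_path M c C P \<and> last P = j}"

lemma finite_path_weights: "finite {\<Sum>i\<in>set P. w i | P. coloured_path M c C P \<and> Q P}"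
proof (rule finite_subset)
  show "{\<Sum>i\<in>set P. w i | P. coloured_path M c C P \<and> Q P} \<subseteq> sum w ` Pow {1..M}"
    by (auto simp: coloured_path_def)
qed simp

lemma coloured_path_singleton: "i \<in> {1..M} \<Longrightarrow> coloured_path M c C [i]"
  by (simp add: coloured_path_def)

lemma path_weight_le_heaviest_ending:
  assumes "coloured_path M c C P"
  shows "(\<Sum>i\<in>set P. w i) \<le> heaviest_ending M c C w (last P)"
  unfolding heaviest_ending_def using assms by (intro Max_ge finite_path_weights) auto

lemma heaviest_ending_attained:
  assumes "j \<in> {1..M}"
  obtains P where "coloured_path M c C P" "last P = j"
    "heaviest_ending M c C w j = (\<Sum>i\<in>set P. w i)"
proof -
  let ?S = "{\<Sum>i\<in>set P. w i | P. coloured_path M c C P \<and> last P = j}"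
  have "?S \<noteq> {}"
    using coloured_path_singleton[OF assms, of c C] by fastforce
  then have "Max ?S \<in> ?S"
    by (intro Max_in finite_path_weights)
  then show thesis
    using that by (auto simp: heaviest_ending_def)
qed

lemma heaviest_ending_singleton:
  assumes "i \<in> {1..M}"
  shows "w i \<le> heaviest_ending M c C w i"
  using path_weight_le_heaviest_ending[OF coloured_path_singleton[OF assms], of w c C] by simp

lemma path_weight_le_max:
  assumes "coloured_path M c C P"
  shows "(\<Sum>i\<in>set P. w i) \<le> max_path_weight M c C w"
  unfolding max_path_weight_def
  using assms finite_path_weights[of w M c C "\<lambda>_. True"] by (intro Max_ge) auto

lemma heaviest_ending_le_max:
  assumes "j \<in> {1..M}"
  shows "heaviest_ending M c C w j \<le> max_path_weight M c C w"
  using heaviest_ending_attained[OF assms] path_weight_le_max by metis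

lemma coloured_path_sorted:
  assumes "coloured_path M c C P"
  shows "sorted_wrt (<) P"
proof -
  have "successively (<) P"
    using assms by (auto simp: coloured_path_def tedge_def elim: successively_mono)
  then show ?thesis
    by (simp add: successively_conv_sorted_wrt)
qed

text \<open>Edges go upwards, so the vertex that prolongs a path is new to it and its weight is
  counted in full.\<close>

lemma heaviest_ending_edge:
  assumes "tedge M i j" "c i j \<in> C"
  shows "heaviest_ending M c C w i + w j \<le> heaviest_ending M c C w j"
proof -
  have "i \<in> {1..M}"
    using assms by (auto simp: tedge_def)
  then obtain P where P: "coloured_path M c C P" "last P = i"
    "heaviest_ending M c C w i = (\<Sum>k\<in>set P. w k)"
    by (rule heaviest_ending_attained)
  have Pj: "coloured_path M c C (P @ [j])"
    using P(1,2) assms by (auto simp: coloured_path_def successively_append_iff tedge_def)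
  then have "j \<notin> set P"
    using coloured_path_sorted[OF Pj] by (auto simp: sorted_wrt_append)
  then show ?thesis
    using path_weight_le_heaviest_ending[OF Pj, of w] P(3) by simp
qed

section \<open>The product inequality for paths and for cliques\<close>

text \<open>Since the two classes cover all colours, each edge \<open>i \<rightarrow> j\<close> raises the heaviest \<open>C\<close>-path
  weight by at least \<open>b j\<close> or the heaviest \<open>D\<close>-path weight by at least \<open>r j\<close>. This is the
  separation of rectangles that the packing bound asks for.\<close>

lemma max_path_weight_product:
  assumes "M \<ge> 1"
    and b: "\<And>i. i \<in> {1..M} \<Longrightarrow> b i \<ge> 0"
    and r: "\<And>i. i \<in> {1..M} \<Longrightarrow> r i \<ge> 0"
    and "C \<union> D = UNIV"
  shows "(\<Sum>i=1..M. b i * r i) \<le> max_path_weight M c C b * max_path_weight M c D r"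
proof (rule sum_areas_le_area)
  let ?f = "heaviest_ending M c C b" and ?g = "heaviest_ending M c D r"
  show f: "0 \<le> b i \<and> b i \<le> ?f i \<and> ?f i \<le> max_path_weight M c C b" if "i \<in> {1..M}" for i
    using b[OF that] heaviest_ending_singleton[OF that] heaviest_ending_le_max[OF that] by blast
  show g: "0 \<le> r i \<and> r i \<le> ?g i \<and> ?g i \<le> max_path_weight M c D r" if "i \<in> {1..M}" for i
    using r[OF that] heaviest_ending_singleton[OF that] heaviest_ending_le_max[OF that] by blast
  show "0 \<le> max_path_weight M c C b" "0 \<le> max_path_weight M c D r"
    using f[of 1] g[of 1] \<open>M \<ge> 1\<close> by auto
  have sep: "?f i \<le> ?f j - b j \<or> ?g i \<le> ?g j - r j"
    if "i \<in> {1..M}" "j \<in> {1..M}" "i < j" for i j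
  proof -
    have "tedge M i j"
      using that by (auto simp: tedge_def)
    moreover have "c i j \<in> C \<or> c i j \<in> D"
      using \<open>C \<union> D = UNIV\<close> by blast
    ultimately show ?thesis
      using heaviest_ending_edge[of M i j c C b] heaviest_ending_edge[of M i j c D r] by linarith
  qed
  show "?f i \<le> ?f j - b j \<or> ?f j \<le> ?f i - b i \<or> ?g i \<le> ?g j - r j \<or> ?g j \<le> ?g i - r i"
    if "i \<in> {1..M}" "j \<in> {1..M}" "i \<noteq> j" for i j
    using sep[of i j] sep[of j i] that by linarith
qed simp

text \<open>Transitivity passes from consecutive vertices of the path to all pairs of its vertices.\<close>

lemma coloured_clique_set_path:
  assumes "transitive_in M c C" "coloured_path M c C P"
  shows "coloured_clique M c C (set P)"
proof -
  let ?E = "\<lambda>i j. tedge M i j \<and> c i j \<in> C"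
  have "transp ?E"
    using assms(1) by (auto simp: transp_def transitive_in_def tedge_def)
  then have sorted: "sorted_wrt ?E P"
    using assms(2) by (simp add: coloured_path_def successively_conv_sorted_wrt)
  have "c i j \<in> C" if "i \<in> set P" "j \<in> set P" "i < j" for i j
  proof -
    obtain k l where kl: "k < length P" "l < length P" "P ! k = i" "P ! l = j"
      using \<open>i \<in> set P\<close> \<open>j \<in> set P\<close> unfolding in_set_conv_nth by blast
    have "\<not> l \<le> k"
      using sorted_wrt_nth_less[OF coloured_path_sorted[OF assms(2)], of l k] kl \<open>i < j\<close>
      by (cases "l = k") auto
    then show ?thesis
      using sorted_wrt_nth_less[OF sorted, of k l] kl by auto
  qed
  then show ?thesis
    using assms(2) by (auto simp: coloured_clique_def coloured_path_def)
qed

lemma max_path_weight_le_max_clique_weight: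
  assumes "M \<ge> 1" "transitive_in M c C"
  shows "max_path_weight M c C w \<le> max_clique_weight M c C w"
  unfolding max_path_weight_def max_clique_weight_def
proof (rule Max_mono)
  show "{\<Sum>i\<in>set P. w i | P. coloured_path M c C P}
      \<subseteq> {\<Sum>i\<in>Q. w i | Q. coloured_clique M c C Q}"
    using coloured_clique_set_path[OF assms(2)] by blast
  show "{\<Sum>i\<in>set P. w i | P. coloured_path M c C P} \<noteq> {}"
    using coloured_path_singleton[of 1 M c C] assms(1) by fastforce
  show "finite {\<Sum>i\<in>Q. w i | Q. coloured_clique M c C Q}"
    by (rule finite_subset[of _ "sum w ` Pow {1..M}"]) (auto simp: coloured_clique_def)
qed

lemma max_path_weight_nonneg:
  assumes "M \<ge> 1" "\<And>i. i \<in> {1..M} \<Longrightarrow> w i \<ge> 0"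
  shows "0 \<le> max_path_weight M c C w"
  using path_weight_le_max[OF coloured_path_singleton[of 1 M], of w c C] assms(2)[of 1] assms(1)
  by simp

theorem theorem3p2:
  fixes M :: nat and c :: "nat \<Rightarrow> nat \<Rightarrow> rbk_colour" and b r :: "nat \<Rightarrow> real"
  assumes "M \<ge> 1"
    and "\<And>i. i \<in> {1..M} \<Longrightarrow> b i \<ge> 0"
    and "\<And>i. i \<in> {1..M} \<Longrightarrow> r i \<ge> 0"
  shows "max_path_weight M c {Col_B, Col_K} b * max_path_weight M c {Col_R, Col_K} r
           \<ge> (\<Sum>i=1..M. b i * r i)
       \<and> (geometric_tournament M c \<longrightarrow>
           max_clique_weight M c {Col_B, Col_K} b * max_clique_weight M c {Col_R, Col_K} r
             \<ge> (\<Sum>i=1..M. b i * r i))"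
proof (intro conjI impI)
  let ?C = "{Col_B, Col_K}" and ?D = "{Col_R, Col_K}"
  have "?C \<union> ?D = UNIV"
    using rbk_colour.exhaust by auto
  with assms show paths:
    "(\<Sum>i=1..M. b i * r i) \<le> max_path_weight M c ?C b * max_path_weight M c ?D r"
    by (rule max_path_weight_product)
  assume "geometric_tournament M c"
  then have "transitive_in M c ?C" "transitive_in M c ?D"
    by (auto simp: geometric_tournament_def)
  then have le: "max_path_weight M c ?C b \<le> max_clique_weight M c ?C b"
    "max_path_weight M c ?D r \<le> max_clique_weight M c ?D r"
    using assms(1) by (simp_all add: max_path_weight_le_max_clique_weight)
  have nonneg: "0 \<le> max_path_weight M c ?C b" "0 \<le> max_path_weight M c ?D r"
    using assms(1) by (auto intro!: max_path_weight_nonneg assms(2,3) simp del: One_nat_def atLeastAtMost_iff)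
  note paths
  also have "max_path_weight M c ?C b * max_path_weight M c ?D r
      \<le> max_clique_weight M c ?C b * max_clique_weight M c ?D r"
    using le nonneg by (intro mult_mono) auto
  finally show "(\<Sum>i=1..M. b i * r i) \<le> max_clique_weight M c ?C b * max_clique_weight M c ?D r" .
qed

end
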